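(* Let $\mathbb{K}$ be a field of characteristic $0$ and let $(A,\mu)$ be an anti-associative algebra over $\mathbb{K}$. Then the commutative multiplication $x\bullet y=\mu(x,y)+\mu(y,x)$ associated with $\mu$ satisfies the Jacobi identity $$x_1\bullet(x_2\bullet x_3)+x_2\bullet(x_3\bullet x_1)+x_3\bullet(x_1\bullet x_2)=0$$ for all $x_1,x_2,x_3\in A$.
   Context: An algebra $(A,\mu)$ over $\mathbb{K}$ is a $\mathbb{K}$-vector space $A$ with a bilinear map $\mu:A\times A\to A$; it is anti-associative if $\mu(\mu(x,y),z)+\mu(x,\mu(y,z))=0$ for all $x,y,z\in A$. *)

theory Defs
  imports Complex_Main
begin

locale algebra_over = vector_space scale
  for scale :: "'k::field \<Rightarrow> 'a::ab_group_add \<Rightarrow> 'a" +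
  fixes mu :: "'a \<Rightarrow> 'a \<Rightarrow> 'a"
  assumes mu_linear_left: "\<And>y. Vector_Spaces.linear scale scale (\<lambda>x. mu x y)"
    and mu_linear_right: "\<And>x. Vector_Spaces.linear scale scale (\<lambda>y. mu x y)"

locale anti_associative_algebra = algebra_over scale mu
  for scale :: "'k::field \<Rightarrow> 'a::ab_group_add \<Rightarrow> 'a" and mu :: "'a \<Rightarrow> 'a \<Rightarrow> 'a" +
  assumes anti_assoc: "\<And>x y z. mu (mu x y) z + mu x (mu y z) = 0"

definition symmetrized_mult :: "('a::ab_group_add \<Rightarrow> 'a \<Rightarrow> 'a) \<Rightarrow> 'a \<Rightarrow> 'a \<Rightarrow> 'a" where
  "symmetrized_mult mu x y = mu x y + mu y x"

definition jacobi_identity :: "('a::ab_group_add \<Rightarrow> 'a \<Rightarrow> 'a) \<Rightarrow> bool" where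
  "jacobi_identity m \<longleftrightarrow>
     (\<forall>x\<^sub>1 x\<^sub>2 x\<^sub>3. m x\<^sub>1 (m x\<^sub>2 x\<^sub>3) + m x\<^sub>2 (m x\<^sub>3 x\<^sub>1) + m x\<^sub>3 (m x\<^sub>1 x\<^sub>2) = 0)"

end

theory Submission
  imports Defs
begin

text \<open>Expanding the cyclic sum gives, for each of the six orderings of the arguments, one
  monomial \<open>mu a (mu b c)\<close> and one \<open>mu (mu a b) c\<close>; anti-associativity
  makes each such pair cancel.\<close>

theorem proposition14:
  fixes scale :: "'k::field_char_0 \<Rightarrow> 'a::ab_group_add \<Rightarrow> 'a"
    and mu :: "'a \<Rightarrow> 'a \<Rightarrow> 'a"
  assumes "anti_associative_algebra scale mu"
  shows "jacobi_identity (symmetrized_mult mu)"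
proof -
  interpret anti_associative_algebra scale mu
    by (fact assms)
  have add_left: "mu (x + y) z = mu x z + mu y z" for x y z
    using module_hom.add[OF Vector_Spaces.linear.axioms(3)[OF mu_linear_left]] .
  have add_right: "mu x (y + z) = mu x y + mu x z" for x y z
    using module_hom.add[OF Vector_Spaces.linear.axioms(3)[OF mu_linear_right]] .
  \<comment> \<open>Oriented as a rewrite rule: every triple product becomes a signed right-nested
    monomial, so the final cancellation is in the additive group.\<close>
  have assoc: "mu (mu x y) z = - mu x (mu y z)" for x y z
    using anti_assoc[of x y z] by (simp add: eq_neg_iff_add_eq_0)
  show ?thesis
    unfolding jacobi_identity_def symmetrized_mult_def
    by (simp add: add_left add_right assoc algebra_simps)
qed

end
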